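(* Suppose two $T$-orbits do not coalesce (i.e. they have no common value), and run the lower-runner race between them. If $p_0$ is the lower initial value, then for every integer $G\ge2$ there is a race state with gap greater than $G$ and lower value at most $$p_0+P_{(G+1)\left\lceil\frac{\log(2G+1)}{\log2}\right\rceil}+2G+1.$$ In particular, for some absolute constant $C>0$, this lower value is at most $$p_0+\exp\bigl(CG\log G\log(G\log G)\bigr),$$ and, as $G\to\infty$, $$\log P_{(G+1)\left\lceil\frac{\log(2G+1)}{\log2}\right\rceil}=\left(\frac1{\log2}+o(1)\right)G\log G\log(G\log G).$$ In particular, the lower-runner gap is unbounded.
   Context: $\tau(n)$ is the number of positive divisors of $n$; $T(n)=n+\tau(n)$ on the positive integers. $p_1<p_2<\cdots$ denote the primes in increasing order and $P_K=\prod_{u\le K}p_u$ is the product of the first $K$ primes (the symbol $p_0$ in the claim is not a prime but the lower initial value). $\log$ is the natural logarithm. Lower-runner race between two forward $T$-orbits: the initial race state consists of the two starting values. At a race state let the current values of the two orbits be $p<q$ ($p$ is the lower value, $g=q-p$ is the gap). Advance the lower value $p$ to $T(p)$ and then reorder the two values. If $T(p)=q$, the two orbits coalesce and the race terminates; otherwise the next gap is $|\tau(p)-g|$ and the next lower value is $p+\min(g,\tau(p))$. *)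

theory Defs
  imports
    Complex_Main
    "HOL-Library.Infinite_Set"
    "HOL-Library.Landau_Symbols"
    "HOL-Computational_Algebra.Primes"
begin

(* The intended domain is the positive integers; at 0 the divisor set is infinite,
   so tau 0 = 0 is a junk value. *)
definition tau :: "nat \<Rightarrow> nat" where
  "tau n = card {d. d dvd n}"

definition tmap :: "nat \<Rightarrow> nat" where
  "tmap n = n + tau n"

definition torbit :: "nat \<Rightarrow> nat set" where
  "torbit a = range (\<lambda>n. (tmap ^^ n) a)"

(* Product of the first K primes; enumerate counts from 0, so the paper's p_u is
   enumerate {p. prime p} (u - 1). *)
definition primorial :: "nat \<Rightarrow> nat" where
  "primorial K = (\<Prod>u<K. enumerate {p::nat. prime p} u)"

(* race_state a b p q: the race started from a and b visits the state with lower value p and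
   upper value q.  There is no successor state when tmap p = q (coalescence). *)
inductive race_state :: "nat \<Rightarrow> nat \<Rightarrow> nat \<Rightarrow> nat \<Rightarrow> bool" for a b :: nat where
  start: "a \<noteq> b \<Longrightarrow> race_state a b (min a b) (max a b)"
| advance: "race_state a b p q \<Longrightarrow> tmap p \<noteq> q \<Longrightarrow>
    race_state a b (min (tmap p) q) (max (tmap p) q)"

lemma race_state_less: "race_state a b p q \<Longrightarrow> p < q"
  by (induction rule: race_state.induct) (auto simp: min_def max_def)

lemma race_advance_lower: "p < q \<Longrightarrow> min (tmap p) q = p + min (q - p) (tau p)"
  by (auto simp: tmap_def min_def)

lemma race_advance_gap:
  "p < q \<Longrightarrow>
    int (max (tmap p) q) - int (min (tmap p) q) = \<bar>int (tau p) - (int q - int p)\<bar>"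
  by (auto simp: tmap_def min_def max_def)

(* The index (G+1) * ceiling (log (2G+1) / log 2) of the primorial in the bound. *)
definition race_index :: "nat \<Rightarrow> nat" where
  "race_index G = (G + 1) * nat \<lceil>ln (2 * real G + 1) / ln 2\<rceil>"

end

theory Submission
  imports Defs "HOL-Number_Theory.Cong" "HOL-Real_Asymp.Real_Asymp"
begin

text \<open>
  Write \<open>L\<close> for the least integer with \<open>2 ^ L \<ge> 2 * G + 1\<close>. The Chinese remainder theorem, applied
  with \<open>L\<close> fresh primes for each of \<open>G + 1\<close> consecutive integers, yields a window of length
  \<open>G + 1\<close> in which every integer has at least \<open>2 ^ L\<close> divisors, and such a window starts within
  one period, the product of the \<open>(G + 1) * L\<close> primes, above any given point
  (\<open>exists_window_tau_ge\<close>). One move raises the lower value by at most the gap. As long as the gap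
  is at most \<open>G\<close>, the lower value therefore cannot jump over the window
  (\<open>race_large_gap_or_lands\<close>); once it is in the window, the next gap is at least
  \<open>(2 * G + 1) - G > G\<close> (\<open>race_gap_exceeds\<close>). Disjointness of the orbits keeps the race
  from stopping before that (\<open>race_state_advance\<close>).

  The asymptotics need much less than the prime number theorem: the logarithm of the product of
  the first \<open>K\<close> primes is asymptotic to \<open>K * ln K\<close> as soon as the \<open>K\<close>-th prime is between \<open>K\<close> and
  \<open>K powr (1 + o(1))\<close>. The lower bound is trivial and gives a comparison with \<open>ln (fact K)\<close>. The
  upper bound is Chebyshev's: every prime power dividing \<open>2 * n choose n\<close> is at most \<open>2 * n\<close>, so
  \<open>2 ^ n \<le> 2 * n choose n \<le> (2 * n) ^ \<pi>(2 * n)\<close>, which forces many primes below \<open>2 * n\<close>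
  (\<open>binomial_le_power_card_primes\<close>, \<open>nth_prime_le\<close>). The exponential bound with an absolute constant
  then follows because a convergent sequence is bounded.
\<close>

section \<open>Integers with many divisors in a short window\<close>

text \<open>Distinct subsets of \<open>A\<close> have distinct products, and all of these products divide \<open>n\<close>.\<close>

lemma two_power_card_le_tau:
  assumes "n > 0" "finite A" "\<And>p. p \<in> A \<Longrightarrow> prime p \<and> p dvd n"
  shows "2 ^ card A \<le> tau n"
proof -
  have fin: "finite {d. d dvd n}"
    using assms(1) by (simp add: finite_divisors_nat)
  have dvd_iff: "q dvd \<Prod>S \<longleftrightarrow> q \<in> S" if "S \<subseteq> A" "q \<in> A" for q S
  proof
    assume "q dvd \<Prod>S"
    moreover have "finite S" using that assms(2) finite_subset by blast
    moreover have "prime q" using that assms(3) by blast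
    ultimately obtain p where "p \<in> S" "q dvd p"
      by (auto simp: prime_dvd_prod_iff)
    then show "q \<in> S"
      using that assms(3) by (metis primes_dvd_imp_eq subsetD)
  qed (use that assms(2) finite_subset in \<open>auto intro: dvd_prodI[of S _ id, simplified]\<close>)
  have "inj_on (\<lambda>S. \<Prod>S) (Pow A)"
  proof (rule inj_onI)
    fix S T assume "S \<in> Pow A" "T \<in> Pow A" "\<Prod>S = \<Prod>T"
    then show "S = T" using dvd_iff[of S] dvd_iff[of T] by auto
  qed
  moreover have "(\<lambda>S. \<Prod>S) ` Pow A \<subseteq> {d. d dvd n}"
  proof clarify
    fix S assume "S \<subseteq> A"
    then have "[n = 0] (mod \<Prod>S)"
      using assms(3)
      by (intro cong_cong_prod_coprime_nat) (auto simp: cong_0_iff intro!: primes_coprime)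
    then show "\<Prod>S dvd n" by (simp add: cong_0_iff)
  qed
  ultimately have "card (Pow A) \<le> card {d. d dvd n}"
    using fin by (metis card_image card_mono)
  then show ?thesis using assms(2) by (simp add: tau_def card_Pow)
qed

text \<open>Indices start from zero: \<open>nth_prime 0 = 2\<close>.\<close>

abbreviation nth_prime :: "nat \<Rightarrow> nat" where
  "nth_prime \<equiv> enumerate {p::nat. prime p}"

lemma prime_nth_prime: "prime (nth_prime u)"
  using enumerate_in_set[OF primes_infinite] by simp

lemma inj_nth_prime: "inj nth_prime"
  using inj_enumerate[OF primes_infinite] .

text \<open>
  The primes are split into \<open>G + 1\<close> blocks of \<open>L\<close>, the prime with index \<open>u\<close> belonging to block
  \<open>u div L\<close>; every prime of block \<open>i\<close> is made to divide \<open>c + x + i\<close>. The shift \<open>c\<close> is built into the congruences,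
  so that the window starts at or above \<open>c\<close> without a later translation by periods.
\<close>

lemma exists_window_tau_ge:
  assumes "c > 0"
  shows "\<exists>x < primorial ((G + 1) * L). \<forall>i\<le>G. 2 ^ L \<le> tau (c + x + i)"
proof -
  let ?K = "(G + 1) * L"
  (* The residue -(c + u div L) modulo the prime, written without subtraction below zero. *)
  let ?r = "\<lambda>u. (nth_prime u - 1) * (c + u div L)"
  have "\<exists>!x. x < (\<Prod>u<?K. nth_prime u) \<and> (\<forall>u\<in>{..<?K}. [x = ?r u] (mod nth_prime u))"
  proof (intro chinese_remainder_unique_nat ballI impI)
    fix u show "nth_prime u \<noteq> 0" using prime_nth_prime[of u] by (metis not_prime_0)
  next
    fix u v :: nat assume "u \<noteq> v"
    then show "coprime (nth_prime u) (nth_prime v)"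
      using prime_nth_prime inj_nth_prime by (metis injD primes_coprime)
  qed auto
  then obtain x where x: "x < primorial ?K"
    and cong: "\<And>u. u < ?K \<Longrightarrow> [x = ?r u] (mod nth_prime u)"
    by (auto simp: primorial_def)
  have dvd: "nth_prime u dvd c + x + u div L" if "u < ?K" for u
  proof -
    have "[x + (c + u div L) = ?r u + (c + u div L)] (mod nth_prime u)"
      using cong[OF that] by (rule cong_add) simp
    also have "?r u + (c + u div L) = nth_prime u * (c + u div L)"
      using prime_gt_0_nat[OF prime_nth_prime[of u]]
      by (cases "nth_prime u") auto
    finally show ?thesis
      by (metis cong_dvd_iff dvd_triv_left add.assoc add.commute)
  qed
  have "2 ^ L \<le> tau (c + x + i)" if "i \<le> G" for i
  proof -
    let ?A = "nth_prime ` {i * L..<(i + 1) * L}"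
    have "card ?A = L"
      using inj_nth_prime by (subst card_image) (auto simp: inj_on_def)
    moreover have "p dvd c + x + i" if "p \<in> ?A" for p
    proof -
      from that obtain u where u: "p = nth_prime u" "i * L \<le> u" "u < (i + 1) * L" by auto
      then have "u div L = i" by (intro div_nat_eqI) (auto simp: algebra_simps)
      moreover have "(i + 1) * L \<le> ?K" using \<open>i \<le> G\<close> by (intro mult_right_mono) auto
      then have "u < ?K" using u by linarith
      ultimately show ?thesis using dvd[of u] u by simp
    qed
    ultimately show ?thesis
      using two_power_card_le_tau[of "c + x + i" ?A] assms prime_nth_prime by auto
  qed
  with x show ?thesis by blast
qed

section \<open>The race meets the window\<close>

lemma torbit_refl: "x \<in> torbit x"
  unfolding torbit_def by (metis funpow_0 rangeI)

lemma tmap_in_torbit: "y \<in> torbit x \<Longrightarrow> tmap y \<in> torbit x"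
  unfolding torbit_def by (metis (no_types, lifting) funpow.simps(2) o_apply rangeE rangeI)

lemma race_state_orbits:
  "race_state a b p q \<Longrightarrow>
     (p \<in> torbit a \<and> q \<in> torbit b) \<or> (p \<in> torbit b \<and> q \<in> torbit a)"
proof (induction rule: race_state.induct)
  case start
  then show ?case by (auto simp: min_def max_def torbit_refl)
next
  case (advance p q)
  then show ?case by (auto simp: min_def max_def tmap_in_torbit)
qed

lemma race_state_advance:
  assumes "torbit a \<inter> torbit b = {}" "race_state a b p q"
  shows "race_state a b (min (tmap p) q) (max (tmap p) q)"
  using race_state_orbits[OF assms(2)] assms(1)
  by (intro race_state.advance[OF assms(2)]) (auto dest: tmap_in_torbit)

lemma race_state_start:
  assumes "torbit a \<inter> torbit b = {}"
  shows "race_state a b (min a b) (max a b)"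
  using assms torbit_refl by (intro race_state.start) auto

lemma race_state_lower_ge: "race_state a b p q \<Longrightarrow> min a b \<le> p"
proof (induction rule: race_state.induct)
  case (advance p q)
  then show ?case using race_state_less[OF advance(1)] by (simp add: tmap_def)
qed simp

lemma tau_pos: "n > 0 \<Longrightarrow> tau n > 0"
  unfolding tau_def by (subst card_gt_0_iff) (auto simp: finite_divisors_nat)

text \<open>
  The largest lower value not above \<open>m\<close> belongs to a state whose successor has a lower value of at
  least \<open>m\<close>. If the gap of that state is at most \<open>G\<close>, the move overshoots \<open>m\<close> by at most \<open>G\<close>.
\<close>

lemma race_large_gap_or_lands:
  assumes disj: "torbit a \<inter> torbit b = {}" and pos: "a > 0" "b > 0" and m: "min a b \<le> m"
  shows "\<exists>p q. race_state a b p q \<and> (p \<le> m \<and> q - p > G \<or> m \<le> p \<and> p \<le> m + G)"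
proof -
  let ?S = "{p. p \<le> m \<and> (\<exists>q. race_state a b p q)}"
  define p where "p = Max ?S"
  have fin: "finite ?S" by (rule finite_subset[of _ "{..m}"]) auto
  moreover have "?S \<noteq> {}" using race_state_start[OF disj] m by blast
  ultimately have "p \<in> ?S" unfolding p_def by (rule Max_in)
  then obtain q where pm: "p \<le> m" and st: "race_state a b p q" by auto
  show ?thesis
  proof (cases "q - p > G")
    case False
    let ?p' = "min (tmap p) q" and ?q' = "max (tmap p) q"
    have st': "race_state a b ?p' ?q'" by (rule race_state_advance[OF disj st])
    have "p < q" by (rule race_state_less[OF st])
    moreover have "tau p > 0" using race_state_lower_ge[OF st] pos by (intro tau_pos) auto
    ultimately have "p < ?p'" by (simp add: tmap_def)
    then have "?p' \<notin> ?S" unfolding p_def using Max_ge[OF fin] leD by blast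
    then have "m \<le> ?p'" using st' by auto
    moreover have "?p' \<le> m + G" using False pm by auto
    ultimately show ?thesis using st' by blast
  qed (use st pm in blast)
qed

text \<open>
  A state whose lower value has at least \<open>2 * G + 1\<close> divisors and whose gap is at most \<open>G\<close> is
  followed by one whose gap exceeds \<open>G\<close>; its lower value is the old upper value, which accounts for
  a further \<open>G\<close> in the bound.
\<close>

lemma race_gap_exceeds:
  assumes disj: "torbit a \<inter> torbit b = {}" and pos: "a > 0" "b > 0"
  shows "\<exists>p q. race_state a b p q \<and> q - p > G \<and>
           p \<le> min a b + primorial (race_index G) + 2 * G + 1"
proof -
  define L where "L = nat \<lceil>ln (2 * real G + 1) / ln 2\<rceil>"
  have idx: "race_index G = (G + 1) * L" by (simp add: race_index_def L_def)
  have "2 * real G + 1 = 2 powr (ln (2 * real G + 1) / ln 2)"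
    by (simp add: powr_def)
  also have "\<dots> \<le> 2 powr real L"
    unfolding L_def by (intro powr_mono real_nat_ceiling_ge) auto
  finally have "2 * real G + 1 \<le> real (2 ^ L)" by (simp add: powr_realpow)
  then have L: "2 * G + 1 \<le> 2 ^ L" by linarith
  obtain x where x: "x < primorial (race_index G)"
    and tau: "\<And>i. i \<le> G \<Longrightarrow> 2 * G + 1 \<le> tau (min a b + x + i)"
    using exists_window_tau_ge[of "min a b" G L] pos L unfolding idx
    by (meson le_trans min_less_iff_conj)
  define m where "m = min a b + x"
  obtain p q where st: "race_state a b p q"
    and alt: "p \<le> m \<and> q - p > G \<or> m \<le> p \<and> p \<le> m + G"
    using race_large_gap_or_lands[OF disj pos, of m G] unfolding m_def by auto
  show ?thesis
  proof (cases "q - p > G")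
    case True
    then show ?thesis using st alt x unfolding m_def
      by (intro exI[of _ p] exI[of _ q]) auto
  next
    case False
    with alt have "m \<le> p" "p \<le> m + G" by auto
    then have tp: "2 * G + 1 \<le> tau p"
      using tau[of "p - m"] unfolding m_def by auto
    have "p < q" by (rule race_state_less[OF st])
    then have "min (tmap p) q = q" "max (tmap p) q = tmap p"
      using tp False by (auto simp: tmap_def min_def max_def)
    then have "race_state a b q (tmap p)"
      using race_state_advance[OF disj st] by simp
    moreover have "tmap p - q > G" using tp False \<open>p < q\<close> by (simp add: tmap_def)
    moreover have "q \<le> min a b + primorial (race_index G) + 2 * G + 1"
      using False \<open>p \<le> m + G\<close> x unfolding m_def by linarith
    ultimately show ?thesis by blast
  qed
qed

section \<open>An upper bound for the primes\<close>

text \<open>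
  The numbers \<open>1 / (k * (N choose k))\<close> form Leibniz's harmonic triangle: each entry of column
  \<open>k + 1\<close> is the difference of two entries of column \<open>k\<close>, and column \<open>1\<close> consists of the
  reciprocals \<open>1 / N\<close>. So a common multiple of \<open>1, \<dots>, N\<close> clears the denominators of all entries
  down to row \<open>N\<close>. In particular every binomial coefficient \<open>N choose k\<close> divides it, and no
  prime multiplicities of factorials have to be computed.
\<close>

lemma leibniz_triangle_dvd:
  assumes "1 \<le> k" "k \<le> N" "\<And>m. 1 \<le> m \<Longrightarrow> m \<le> N \<Longrightarrow> m dvd (d::nat)"
  shows "k * (N choose k) dvd d"
  using assms
proof (induction k arbitrary: N rule: nat_induct_at_least)
  case base
  then show ?case by simp
next
  case (Suc k)
  then obtain M where N: "N = Suc M" by (cases N) auto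
  have "k \<le> M" using Suc.prems N by simp
  have "k * (M choose k) dvd d" "k * (N choose k) dvd d"
    using Suc.IH[of M] Suc.IH[of N] Suc.prems \<open>k \<le> M\<close> N by auto
  then obtain s t where s: "d = k * (M choose k) * s" and t: "d = k * (N choose k) * t"
    unfolding dvd_def by blast
  define c where "c = Suc k * (N choose Suc k)"
  have c1: "c = Suc M * (M choose k)"
    unfolding c_def N by (rule Suc_times_binomial)
  have "(N - k) * (N choose k) = N * ((N - 1) choose k)"
    by (rule binomial_absorb_comp)
  then have c2: "c = (N - k) * (N choose k)" unfolding c1 N by simp
  (* d / c = d / (k * (M choose k)) - d / (k * (N choose k)), with denominators cleared. *)
  have "int k * (int c * (int s - int t)) = int N * int d - int (N - k) * int d"
  proof -
    have "int k * (int c * int s) = int N * int d"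
      unfolding c1 s N by (simp add: algebra_simps)
    moreover have "int k * (int c * int t) = int (N - k) * int d"
      unfolding c2 by (subst t) (simp only: of_nat_mult ac_simps)
    ultimately show ?thesis by (simp add: algebra_simps)
  qed
  also have "\<dots> = int k * int d" using \<open>k \<le> M\<close> N by (simp add: of_nat_diff algebra_simps)
  finally have "int d = int c * (int s - int t)" using Suc.hyps by simp
  then have "int c dvd int d" by (rule dvdI)
  then show ?case unfolding c_def by (simp only: int_dvd_int_iff)
qed

text \<open>
  Take for \<open>d\<close> the least common multiple of \<open>1, \<dots>, N\<close>. It is a product of prime powers, one for each
  prime up to \<open>N\<close> and each at most \<open>N\<close>.
\<close>

lemma binomial_le_power_card_primes:
  assumes "k \<le> N"
  shows "N choose k \<le> N ^ card {p. prime p \<and> p \<le> N}"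
proof (cases "k = 0")
  case True
  have none: "{p::nat. prime p \<and> p \<le> 0} = {}" by auto
  show ?thesis by (cases "N = 0") (use True in \<open>simp_all add: none del: le_zero_eq\<close>)
next
  case False
  let ?P = "{p. prime p \<and> p \<le> N}"
  define v where "v p = Max (multiplicity p ` {1..N})" for p
  define d where "d = (\<Prod>p\<in>?P. p ^ v p)"
  have fin: "finite ?P" by (rule finite_subset[of _ "{..N}"]) auto
  have ne: "multiplicity p ` {1..N} \<noteq> {}" for p using False assms by auto
  have pow_le: "p ^ v p \<le> N" if "p \<in> ?P" for p
  proof -
    have "v p \<in> multiplicity p ` {1..N}" unfolding v_def by (rule Max_in) (use ne in auto)
    then obtain m where "m \<in> {1..N}" "v p = multiplicity p m" by auto
    then show ?thesis
      by (metis atLeastAtMost_iff dvd_imp_le le_trans less_le_trans multiplicity_dvd zero_less_one)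
  qed
  have "m dvd d" if "1 \<le> m" "m \<le> N" for m
  proof -
    have sub: "prime_factors m \<subseteq> ?P"
      using that by (auto simp: prime_factors_dvd dest: dvd_imp_le)
    have "m = (\<Prod>p\<in>prime_factors m. p ^ multiplicity p m)"
      using that by (intro prime_factorization_nat) auto
    also have "\<dots> dvd (\<Prod>p\<in>prime_factors m. p ^ v p)"
      using that unfolding v_def by (intro prod_dvd_prod le_imp_power_dvd Max_ge) auto
    also have "\<dots> dvd d"
      unfolding d_def by (rule prod_dvd_prod_subset[OF fin sub])
    finally show ?thesis .
  qed
  then have "k * (N choose k) dvd d"
    using leibniz_triangle_dvd[of k N d] False assms by simp
  moreover have "d > 0" unfolding d_def by (intro prod_pos) (auto simp: prime_gt_0_nat)
  ultimately have "k * (N choose k) \<le> d" by (rule dvd_imp_le)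
  moreover have "1 * (N choose k) \<le> k * (N choose k)"
    using False by (intro mult_right_mono) auto
  moreover have "d \<le> (\<Prod>p\<in>?P. N)" unfolding d_def using pow_le by (intro prod_mono) auto
  ultimately have "N choose k \<le> (\<Prod>p\<in>?P. N)" by linarith
  then show ?thesis by simp
qed

lemma card_primes_below_nth_prime: "card {p. prime p \<and> p < nth_prime k} = k"
proof -
  have "{p. prime p \<and> p < nth_prime k} = nth_prime ` {..<k}"
  proof (intro equalityI subsetI)
    fix p assume p: "p \<in> {p. prime p \<and> p < nth_prime k}"
    then obtain u where "nth_prime u = p" using enumerate_Ex[OF primes_infinite, of p] by auto
    with p show "p \<in> nth_prime ` {..<k}"
      using enumerate_mono_iff[OF primes_infinite] by auto
  qed (use prime_nth_prime primes_infinite in auto)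
  then show ?thesis using inj_nth_prime by (simp add: card_image inj_on_def)
qed

lemma ln_2_gt_half: "ln (2::real) > 1 / 2"
proof -
  have "exp (1::real) < 2 ^ 2" using exp_le by simp
  then have "ln (exp (1::real)) < ln (2 ^ 2)" by (subst ln_less_cancel_iff) auto
  also have "ln (2 ^ 2 :: real) = 2 * ln 2" by (subst ln_realpow) auto
  finally show ?thesis by simp
qed

text \<open>
  With \<open>p = nth_prime k\<close> there are exactly \<open>k\<close> primes below \<open>p\<close>, hence at most \<open>k\<close> up to the
  largest even number \<open>2 * n < p\<close>, and \<open>2 ^ n \<le> (2 * n choose n) \<le> p ^ k\<close>.
\<close>

lemma nth_prime_le_mult_ln:
  "real (nth_prime k) \<le> 8 * (real k + 1) * ln (real (nth_prime k))"
proof -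
  define p where "p = nth_prime k"
  define n where "n = (p - 1) div 2"
  have p2: "p \<ge> 2" unfolding p_def by (rule prime_ge_2_nat[OF prime_nth_prime])
  have n2: "2 * n < p" "p \<le> 2 * n + 2" using p2 unfolding n_def by auto
  have "(2::real) ^ n \<le> real p ^ k"
  proof (cases "n = 0")
    case False
    have "(2::real) ^ n = (real (2 * n) / real n) ^ n" using False by simp
    also have "\<dots> \<le> real (2 * n choose n)" by (rule binomial_ge_n_over_k_pow_k) auto
    also have "(2 * n choose n) \<le> (2 * n) ^ card {q. prime q \<and> q \<le> 2 * n}"
      by (rule binomial_le_power_card_primes) simp
    also have "\<dots> \<le> (2 * n) ^ k"
    proof (rule power_increasing)
      have "card {q. prime q \<and> q \<le> 2 * n} \<le> card {q. prime q \<and> q < p}"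
        using n2 by (intro card_mono) auto
      then show "card {q. prime q \<and> q \<le> 2 * n} \<le> k"
        unfolding p_def card_primes_below_nth_prime .
    qed (use False in simp)
    also have "\<dots> \<le> p ^ k" using n2 by (intro power_mono) auto
    finally show ?thesis by simp
  qed (use p2 in simp)
  then have "ln ((2::real) ^ n) \<le> ln (real p ^ k)" using p2 by (subst ln_le_cancel_iff) auto
  then have le: "real n * ln 2 \<le> real k * ln (real p)" using p2 by (simp add: ln_realpow)
  have ln2: "ln (2::real) \<ge> 1/2" using ln_2_gt_half by simp
  have "real n * (1/2) \<le> real n * ln 2" using ln2 by (intro mult_left_mono) auto
  then have n_le: "real n \<le> 2 * (real k * ln (real p))" using le by linarith
  have "ln (real p) \<ge> ln 2" using p2 by (subst ln_le_cancel_iff) auto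
  then have lnp: "ln (real p) \<ge> 1/2" using ln2 by linarith
  have "real p \<le> 2 * real n + 2" using n2 by linarith
  also have "\<dots> \<le> 4 * (real k * ln (real p)) + 4 * ln (real p)" using n_le lnp by linarith
  also have "\<dots> \<le> 8 * (real k + 1) * ln (real p)" using lnp by (simp add: algebra_simps)
  finally show ?thesis unfolding p_def .
qed

text \<open>
  Bootstrapping: \<open>ln p \<le> 2 * sqrt p\<close> turns the previous inequality into a crude quadratic bound for
  \<open>p\<close>, and inserting that bound into the logarithm gives the right order of growth.
\<close>

lemma nth_prime_le:
  "real (nth_prime k) \<le> 8 * (real k + 1) * ln (256 * (real k + 1)\<^sup>2)"
proof -
  define p where "p = real (nth_prime k)"
  have p1: "p > 1"
    unfolding p_def using prime_gt_1_nat[OF prime_nth_prime[of k]] by simp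
  have main: "p \<le> 8 * (real k + 1) * ln p" unfolding p_def by (rule nth_prime_le_mult_ln)
  have "ln p \<le> 2 * sqrt p"
    using ln_bound[of "sqrt p"] p1 by (simp add: ln_sqrt)
  then have "8 * (real k + 1) * ln p \<le> 8 * (real k + 1) * (2 * sqrt p)"
    by (intro mult_left_mono) auto
  then have "p \<le> 16 * (real k + 1) * sqrt p" using main by (simp add: algebra_simps)
  then have "sqrt p * sqrt p \<le> 16 * (real k + 1) * sqrt p" using p1 by simp
  then have "sqrt p \<le> 16 * (real k + 1)" using p1 by (subst (asm) mult_le_cancel_right_pos) auto
  then have "(sqrt p)\<^sup>2 \<le> (16 * (real k + 1))\<^sup>2" using p1 by (intro power_mono) auto
  then have "p \<le> 256 * (real k + 1)\<^sup>2"
    using p1 unfolding power_mult_distrib by simp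
  then have "ln p \<le> ln (256 * (real k + 1)\<^sup>2)" using p1 by (subst ln_le_cancel_iff) auto
  then have "8 * (real k + 1) * ln p \<le> 8 * (real k + 1) * ln (256 * (real k + 1)\<^sup>2)"
    by (intro mult_left_mono) auto
  with main show ?thesis unfolding p_def by linarith
qed

section \<open>The size of the primorial\<close>

lemma ln_fact_ge: "real n * (ln (real n) - 1) \<le> ln (fact n :: real)"
proof (induction n)
  case (Suc n)
  have "real (Suc n) * (ln (real (Suc n)) - 1) \<le> real n * (ln (real n) - 1) + ln (real (Suc n))"
  proof (cases "n = 0")
    case False
    have "ln (1 + 1 / real n) \<le> 1 / real n" by (rule ln_add_one_self_le_self) simp
    moreover have "1 + 1 / real n = real (Suc n) / real n" using False by (simp add: field_simps)
    ultimately have "ln (real (Suc n)) - ln (real n) \<le> 1 / real n"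
      using False by (simp add: ln_div)
    then have "real n * (ln (real (Suc n)) - ln (real n)) \<le> real n * (1 / real n)"
      by (intro mult_left_mono) auto
    then show ?thesis using False by (simp add: algebra_simps)
  qed simp
  also have "\<dots> \<le> ln (fact n) + ln (real (Suc n))" using Suc by simp
  also have "\<dots> = ln (fact (Suc n))" by (simp add: ln_mult)
  finally show ?case .
qed simp

lemma primorial_pos: "primorial K > 0"
  unfolding primorial_def by (intro prod_pos) (auto simp: prime_gt_0_nat prime_nth_prime)

text \<open>The prime with index \<open>u\<close> is at least \<open>u + 1\<close>, so \<open>fact K \<le> primorial K\<close>.\<close>

lemma ln_primorial_ge: "real K * (ln (real K) - 1) \<le> ln (real (primorial K))"
proof -
  have "fact K = (\<Prod>u<K. Suc u)" by (induction K) auto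
  also have "\<dots> \<le> primorial K"
  proof -
    have "Suc u \<le> nth_prime u" for u
    proof (induction u)
      case 0
      then show ?case using prime_gt_0_nat[OF prime_nth_prime] by (simp add: Suc_le_eq)
    next
      case (Suc u)
      then show ?case
        using enumerate_step[OF primes_infinite, of u] by linarith
    qed
    then show ?thesis unfolding primorial_def by (intro prod_mono) auto
  qed
  finally have "(fact K :: real) \<le> real (primorial K)"
    by (metis of_nat_fact of_nat_le_iff)
  then have "ln (fact K :: real) \<le> ln (real (primorial K))"
    using primorial_pos[of K] by (subst ln_le_cancel_iff) auto
  with ln_fact_ge[of K] show ?thesis by linarith
qed

text \<open>Estimating every prime by the largest one loses only a lower-order term in the logarithm.\<close>

lemma ln_primorial_le:
  "ln (real (primorial K)) \<le> real K * ln (8 * real K * ln (256 * (real K)\<^sup>2))"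
proof (cases K)
  case (Suc k)
  have pos: "nth_prime u > 0" for u by (simp add: prime_gt_0_nat prime_nth_prime)
  have "primorial K \<le> (\<Prod>u<K. nth_prime k)"
    unfolding primorial_def Suc
    using enumerate_mono_le_iff[OF primes_infinite] by (intro prod_mono) auto
  then have "real (primorial K) \<le> real (nth_prime k) ^ K"
    by (simp flip: of_nat_power)
  then have "ln (real (primorial K)) \<le> ln (real (nth_prime k) ^ K)"
    using primorial_pos[of K] pos[of k] by (subst ln_le_cancel_iff) auto
  also have "\<dots> = real K * ln (real (nth_prime k))" using pos[of k] by (simp add: ln_realpow)
  also have "\<dots> \<le> real K * ln (8 * real K * ln (256 * (real K)\<^sup>2))"
  proof (intro mult_left_mono)
    have le: "real (nth_prime k) \<le> 8 * real K * ln (256 * (real K)\<^sup>2)"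
      using nth_prime_le[of k] by (simp add: Suc add.commute)
    moreover have "0 < real (nth_prime k)" using pos[of k] by simp
    ultimately show "ln (real (nth_prime k)) \<le> ln (8 * real K * ln (256 * (real K)\<^sup>2))"
      by (subst ln_le_cancel_iff) linarith+
  qed simp
  finally show ?thesis .
qed (simp add: primorial_def)

section \<open>Asymptotics of the primorial in the race bound\<close>

definition growth :: "nat \<Rightarrow> real" where
  "growth G = real G * ln (real G) * ln (real G * ln (real G))"

text \<open>The bound on \<open>G\<close> makes \<open>G * ln G\<close> exceed \<open>1\<close>, as \<open>2 * ln 2 > 1\<close>.\<close>

lemma growth_pos:
  assumes "G \<ge> 2"
  shows "growth G > 0"
proof -
  have ln2: "ln (2::real) > 1/2" by (rule ln_2_gt_half)
  have "ln 2 \<le> ln (real G)" using assms by (subst ln_le_cancel_iff) auto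
  then have "2 * ln 2 \<le> real G * ln (real G)" using assms by (intro mult_mono) auto
  then have "1 < real G * ln (real G)" using ln2 by linarith
  then have "0 < ln (real G * ln (real G))" by (rule ln_gt_zero)
  moreover have "0 < ln (real G)" using assms by (intro ln_gt_zero) auto
  ultimately show ?thesis using assms unfolding growth_def by simp
qed

text \<open>
  Removing the ceiling bounds \<open>race_index G\<close> between two elementary functions of \<open>G\<close>. The two bounds
  for the primorial are increasing in the index where they matter, and the resulting
  elementary functions of \<open>G\<close> have the same limit after division by \<open>growth G\<close>.
\<close>

lemma ln_primorial_race_index_asymp:
  "(\<lambda>G. ln (real (primorial (race_index G))) / growth G) \<longlonglongrightarrow> 1 / ln 2"
proof (rule tendsto_sandwich)
  define lo where "lo x = (x + 1) * (ln (2 * x + 1) / ln 2)" for x :: real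
  define hi where "hi x = (x + 1) * (ln (2 * x + 1) / ln 2 + 1)" for x :: real
  have idx: "lo (real G) \<le> real (race_index G)" "real (race_index G) \<le> hi (real G)" for G
  proof -
    let ?y = "ln (2 * real G + 1) / ln 2"
    have "?y \<le> real (nat \<lceil>?y\<rceil>)" by (rule real_nat_ceiling_ge)
    then show "lo (real G) \<le> real (race_index G)"
      unfolding race_index_def lo_def of_nat_mult by (intro mult_mono) auto
    have "0 \<le> ?y" by (intro divide_nonneg_pos ln_ge_zero) auto
    then have "real (nat \<lceil>?y\<rceil>) \<le> ?y + 1" by linarith
    then show "real (race_index G) \<le> hi (real G)"
      unfolding race_index_def hi_def of_nat_mult using \<open>0 \<le> ?y\<close>
      by (intro mult_mono) linarith+
  qed
  have growth_ev_pos: "\<forall>\<^sub>F G in sequentially. growth G > 0"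
    using eventually_ge_at_top[of 2] by eventually_elim (rule growth_pos)
  have lo_big: "\<forall>\<^sub>F G in sequentially. lo (real G) > 3" unfolding lo_def by real_asymp
  show "\<forall>\<^sub>F G in sequentially. lo (real G) * (ln (lo (real G)) - 1) / growth G
          \<le> ln (real (primorial (race_index G))) / growth G"
    using growth_ev_pos lo_big
  proof eventually_elim
    case (elim G)
    have "exp 1 \<le> lo (real G)" using elim exp_le by linarith
    then have "1 \<le> ln (lo (real G))" using elim by (subst ln_ge_iff) auto
    moreover have "ln (lo (real G)) \<le> ln (real (race_index G))"
      using idx(1)[of G] elim by (subst ln_le_cancel_iff) linarith+
    ultimately have "lo (real G) * (ln (lo (real G)) - 1)
        \<le> real (race_index G) * (ln (real (race_index G)) - 1)"
      using idx(1)[of G] elim by (intro mult_mono) auto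
    also have "\<dots> \<le> ln (real (primorial (race_index G)))" by (rule ln_primorial_ge)
    finally show ?case using elim by (intro divide_right_mono) auto
  qed
  show "\<forall>\<^sub>F G in sequentially. ln (real (primorial (race_index G))) / growth G
          \<le> hi (real G) * ln (8 * hi (real G) * ln (256 * (hi (real G))\<^sup>2)) / growth G"
    using growth_ev_pos lo_big
  proof eventually_elim
    case (elim G)
    define K where "K = real (race_index G)"
    have K: "3 < K" "K \<le> hi (real G)" using idx[of G] elim unfolding K_def by linarith+
    have "ln (256 * K\<^sup>2) \<le> ln (256 * (hi (real G))\<^sup>2)"
      using K by (subst ln_le_cancel_iff) (auto intro!: power_mono)
    moreover have ln1: "1 \<le> ln (256 * K\<^sup>2)"
    proof (subst ln_ge_iff)
      have "1 \<le> K\<^sup>2" using K by simp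
      then show "0 < 256 * K\<^sup>2" "exp 1 \<le> 256 * K\<^sup>2" using exp_le by linarith+
    qed
    ultimately have arg: "8 * K * ln (256 * K\<^sup>2) \<le> 8 * hi (real G) * ln (256 * (hi (real G))\<^sup>2)"
      using K ln1 by (intro mult_mono) linarith+
    have "1 * 1 \<le> 8 * K * ln (256 * K\<^sup>2)" using K ln1 by (intro mult_mono) linarith+
    with arg have "ln (8 * K * ln (256 * K\<^sup>2)) \<le> ln (8 * hi (real G) * ln (256 * (hi (real G))\<^sup>2))"
      "0 \<le> ln (8 * K * ln (256 * K\<^sup>2))"
      by (auto simp: ln_le_cancel_iff)
    then have "K * ln (8 * K * ln (256 * K\<^sup>2))
        \<le> hi (real G) * ln (8 * hi (real G) * ln (256 * (hi (real G))\<^sup>2))"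
      using K by (intro mult_mono) auto
    with ln_primorial_le[of "race_index G"] show ?case
      using elim unfolding K_def by (intro divide_right_mono) auto
  qed
  show "(\<lambda>G. lo (real G) * (ln (lo (real G)) - 1) / growth G) \<longlonglongrightarrow> 1 / ln 2"
    unfolding lo_def growth_def by (real_asymp simp: inverse_eq_divide)
  show "(\<lambda>G. hi (real G) * ln (8 * hi (real G) * ln (256 * (hi (real G))\<^sup>2)) / growth G)
          \<longlonglongrightarrow> 1 / ln 2"
    unfolding hi_def growth_def by (real_asymp simp: inverse_eq_divide)
qed

text \<open>
  The additive terms are absorbed by \<open>P + 2 * G + 1 \<le> P * (2 * G + 2)\<close> for \<open>P \<ge> 1\<close>. The logarithm of
  the right-hand side divided by \<open>growth G\<close> converges, so it is bounded, and one constant serves for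
  all \<open>G \<ge> 2\<close>, where \<open>growth G\<close> is positive.
\<close>

lemma primorial_race_index_le_exp:
  "\<exists>C>0. \<forall>G\<ge>2. real (primorial (race_index G) + 2 * G + 1) \<le> exp (C * growth G)"
proof -
  let ?P = "\<lambda>G. real (primorial (race_index G))"
  define s where "s G = ln (?P G) / growth G + ln (2 * real G + 2) / growth G" for G
  have "(\<lambda>G::nat. ln (2 * real G + 2) / growth G) \<longlonglongrightarrow> 0"
    unfolding growth_def by real_asymp
  with ln_primorial_race_index_asymp have "s \<longlonglongrightarrow> 1 / ln 2 + 0"
    unfolding s_def by (rule tendsto_add)
  then have "Bseq s" by (intro convergent_imp_Bseq convergentI)
  then obtain C where C: "C > 0" "\<And>G. norm (s G) \<le> C" by (auto elim: BseqE)
  have "real (primorial (race_index G) + 2 * G + 1) \<le> exp (C * growth G)" if "G \<ge> 2" for G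
  proof -
    have P: "?P G \<ge> 1" using primorial_pos[of "race_index G"] by simp
    have "s G \<le> C" using C(2)[of G] by simp
    then have "s G * growth G \<le> C * growth G"
      using growth_pos[OF that] by (intro mult_right_mono) auto
    then have "ln (?P G) + ln (2 * real G + 2) \<le> C * growth G"
      using growth_pos[OF that] unfolding s_def by (simp add: add_divide_distrib[symmetric])
    moreover have "ln (?P G) + ln (2 * real G + 2) = ln (?P G * (2 * real G + 2))"
      using P by (simp add: ln_mult)
    moreover have "?P G * (2 * real G + 2) > 0" using P by simp
    ultimately have "?P G * (2 * real G + 2) \<le> exp (C * growth G)"
      by (metis exp_le_cancel_iff exp_ln)
    moreover have "?P G * (2 * real G + 2) \<ge> ?P G + 2 * real G + 1"
    proof -
      have "1 * (2 * real G + 1) \<le> ?P G * (2 * real G + 1)" using P by (intro mult_right_mono) auto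
      then show ?thesis by (simp add: algebra_simps)
    qed
    ultimately show ?thesis by simp
  qed
  with C(1) show ?thesis by blast
qed

section \<open>Growth of the gap in the lower-runner race\<close>

theorem theorem10p6:
  shows
    "(\<exists>C::real. C > 0 \<and>
       (\<forall>a b :: nat. a > 0 \<longrightarrow> b > 0 \<longrightarrow> torbit a \<inter> torbit b = {} \<longrightarrow>
          (\<forall>G::nat. G \<ge> 2 \<longrightarrow>
             (\<exists>p q. race_state a b p q \<and> q - p > G \<and>
                p \<le> min a b + primorial (race_index G) + 2 * G + 1 \<and>
                real p \<le> real (min a b) +
                  exp (C * real G * ln (real G) * ln (real G * ln (real G)))))))
     \<and> (\<exists>\<epsilon> :: nat \<Rightarrow> real. \<epsilon> \<in> o(\<lambda>_. 1) \<and>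
          (\<forall>\<^sub>F G in sequentially. ln (real (primorial (race_index G))) =
             (1 / ln 2 + \<epsilon> G) * real G * ln (real G) * ln (real G * ln (real G))))
     \<and> (\<forall>a b :: nat. a > 0 \<longrightarrow> b > 0 \<longrightarrow> torbit a \<inter> torbit b = {} \<longrightarrow>
          \<not> bdd_above {q - p | p q. race_state a b p q})"
proof (intro conjI)
  obtain C where C: "C > 0"
    "\<And>G. G \<ge> 2 \<Longrightarrow> real (primorial (race_index G) + 2 * G + 1) \<le> exp (C * growth G)"
    using primorial_race_index_le_exp by blast
  have "\<exists>p q. race_state a b p q \<and> q - p > G \<and>
          p \<le> min a b + primorial (race_index G) + 2 * G + 1 \<and>
          real p \<le> real (min a b) + exp (C * real G * ln (real G) * ln (real G * ln (real G)))"
    if pos: "a > 0" "b > 0" and disj: "torbit a \<inter> torbit b = {}" and G: "G \<ge> 2" for a b G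
  proof -
    obtain p q where pq: "race_state a b p q" "q - p > G"
      "p \<le> min a b + primorial (race_index G) + 2 * G + 1"
      using race_gap_exceeds[OF disj pos, of G] by blast
    have "real p \<le> real (min a b) + real (primorial (race_index G) + 2 * G + 1)"
      using pq(3) by linarith
    also have "\<dots> \<le> real (min a b) + exp (C * growth G)" using C(2)[OF G] by simp
    finally have "real p \<le> real (min a b) + exp (C * real G * ln (real G) * ln (real G * ln (real G)))"
      by (simp only: growth_def mult.assoc)
    with pq show ?thesis by blast
  qed
  with C(1) show "\<exists>C::real. C > 0 \<and>
       (\<forall>a b :: nat. a > 0 \<longrightarrow> b > 0 \<longrightarrow> torbit a \<inter> torbit b = {} \<longrightarrow>
          (\<forall>G::nat. G \<ge> 2 \<longrightarrow>
             (\<exists>p q. race_state a b p q \<and> q - p > G \<and>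
                p \<le> min a b + primorial (race_index G) + 2 * G + 1 \<and>
                real p \<le> real (min a b) +
                  exp (C * real G * ln (real G) * ln (real G * ln (real G))))))"
    by blast
next
  define \<epsilon> where "\<epsilon> G = ln (real (primorial (race_index G))) / growth G - 1 / ln 2" for G
  have "\<epsilon> \<longlonglongrightarrow> 1 / ln 2 - 1 / ln 2"
    unfolding \<epsilon>_def by (intro tendsto_diff ln_primorial_race_index_asymp tendsto_const)
  then have "\<epsilon> \<in> o(\<lambda>_. 1)" by (intro smalloI_tendsto) auto
  moreover have "\<forall>\<^sub>F G in sequentially. ln (real (primorial (race_index G))) =
      (1 / ln 2 + \<epsilon> G) * real G * ln (real G) * ln (real G * ln (real G))"
    using eventually_ge_at_top[of 2]
  proof eventually_elim
    case (elim G)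
    have "(1 / ln 2 + \<epsilon> G) * growth G = ln (real (primorial (race_index G)))"
      using growth_pos[OF elim] unfolding \<epsilon>_def by simp
    then show ?case by (simp only: growth_def mult.assoc)
  qed
  ultimately show "\<exists>\<epsilon> :: nat \<Rightarrow> real. \<epsilon> \<in> o(\<lambda>_. 1) \<and>
      (\<forall>\<^sub>F G in sequentially. ln (real (primorial (race_index G))) =
         (1 / ln 2 + \<epsilon> G) * real G * ln (real G) * ln (real G * ln (real G)))"
    by blast
next
  show "\<forall>a b :: nat. a > 0 \<longrightarrow> b > 0 \<longrightarrow> torbit a \<inter> torbit b = {} \<longrightarrow>
      \<not> bdd_above {q - p | p q. race_state a b p q}"
  proof (intro allI impI notI)
    fix a b :: nat
    assume "a > 0" "b > 0" "torbit a \<inter> torbit b = {}"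
      and "bdd_above {q - p | p q. race_state a b p q}"
    then obtain B where "\<And>p q. race_state a b p q \<Longrightarrow> q - p \<le> B"
      unfolding bdd_above_def by blast
    with race_gap_exceeds[of a b B] \<open>a > 0\<close> \<open>b > 0\<close> \<open>torbit a \<inter> torbit b = {}\<close>
    show False using leD by blast
  qed
qed

end
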